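(* Let $(X,Y,\langle\cdot,\cdot\rangle)$ be a dual system and let $n\in\{2,3,\dots\}\cup\{\infty\}$. Let $T:X\rightrightarrows Y$. Then $T$ is maximal $n$-monotone if and only if one (equivalently, each) of the following conditions holds: (i) $\operatorname{Graph}T\supset[\varphi_T^{\langle n-1\rangle}\le c]$ (equivalently, $\operatorname{Graph}T=[\varphi_T^{\langle n-1\rangle}\le c]$); (ii) $\varphi_T^{\langle n-1\rangle}\ge c$ and $\operatorname{Graph}T=[\varphi_T^{\langle n-1\rangle}=c]$; (iii) $\varphi_T^{\langle n-1\rangle}\ge c$ and $T$ is $n$-representable; (iv) $T$ is $n$-representable and, for every $(x,y)\in X\times Y$, condition $C_n(x,y)$ holds.
   Context: All vector spaces are real. A dual system $(X,Y,\langle\cdot,\cdot\rangle)$ consists of vector spaces $X,Y$ and a bilinear map $c=\langle\cdot,\cdot\rangle:X\times Y\to\mathbb{R}$; $X$ and $Y$ carry the weak topologies $\sigma(X,Y)$, $\sigma(Y,X)$. Put $Z=X\times Y$, $c(x,y)=\langle x,y\rangle$, and $z\cdot w=\langle x,v\rangle+\langle u,y\rangle$ for $z=(x,y)$, $w=(u,v)\in Z$; $Z$ carries the product topology $\sigma(X,Y)\times\sigma(Y,X)$ (or any locally convex topology compatible with the duality $(Z,Z,\cdot)$). For $f:Z\to\overline{\mathbb{R}}$, $f^{\square}(z)=\sup_{z'\in Z}\{z\cdot z'-f(z')\}$. $\Gamma(Z)$ is the set of proper convex lower semicontinuous functions $Z\to\overline{\mathbb R}$ (proper: not identically $+\infty$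 and never $-\infty$). $[f\le g]=\{z\mid f(z)\le g(z)\}$, and similarly $[f=g]$; $f\le g$ without brackets means the inequality holds at every point. Conventions: $\sup\emptyset=-\infty$, $\inf\emptyset=+\infty$, $\infty-1=\infty$. $T:X\rightrightarrows Y$ is a multifunction with $\operatorname{Graph}T=\{(x,y)\mid y\in T(x)\}$. For finite $n$, $T$ is $n$-monotone if $\sum_{i=1}^n\langle x_i-x_{i+1},y_i\rangle\ge0$ for all $(x_1,y_1),\dots,(x_n,y_n)\in\operatorname{Graph}T$, with $x_{n+1}=x_1$; $T$ is $\infty$-monotone (cyclically monotone) if it is $k$-monotone for every integer $k\ge2$. $T$ is maximal $n$-monotone if it is $n$-monotone and its graph is not properly contained in the graph of another $n$-monotone operator. The $n$-th Fitzpatrick function: for finite $n\ge1$, $\varphi_T^{\langle n\rangle}(x,y)=\sup\{\langle x-x_1,y_1\rangle+\sum_{i=2}^n\langle x_{i-1}-x_i,y_i\rangle+\langle x_n,y\rangle\mid (x_i,y_i)\in\operatorname{Graph}T,\ 1\le i\le n\}$, and $\varphi_T^{\langle\infty\rangle}=\sup_{n\ge1}\varphi_T^{\langle n\rangle}$. Also $\psi_T^{\langle n\rangle}=(\varphi_T^{\langle n\rangle})^{\square}$. $T$ is $n$-representable if $T$ is $n$-monotone and there exists $f\in\Gamma(Z)$ such that $c\le f\le\max\{\varphi_T^{\langle n-1\rangle},\psi_T^{\langle n-1\rangle}\}$ and $\operatorname{Graph}T=[f=c]$. Conditions $C_n(x,y)$: $C_2(x,y)$: there is $(x_1,y_1)\in\operatorname{Graph}T$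 with $\langle x-x_1,y_1\rangle+\langle x_1-x,y\rangle\ge0$. For $3\le n<\infty$, $C_n(x,y)$: there are $(x_i,y_i)\in\operatorname{Graph}T$, $1\le i\le n-1$, with $\langle x-x_1,y_1\rangle+\sum_{i=2}^{n-1}\langle x_{i-1}-x_i,y_i\rangle+\langle x_{n-1}-x,y\rangle\ge0$. $C_\infty(x,y)$: there is an integer $m\ge2$ such that $C_m(x,y)$ holds.
   Formalization: In (i), the inclusion form Graph T ⊃ [φ ≤ c] is stated with the added requirement that T is n-monotone, since without it the claim fails (X = Y = ℝ, T(x) = ℝ for all x, n = 2); the equality form needs no such requirement. *)

theory Defs
  imports "HOL-Analysis.Analysis"
begin

text \<open>
  A dual system is a pair of real vector spaces, given by types of class
  \<^class>\<open>real_vector\<close>, together with a map \<open>c\<close> such that \<open>bilinear c\<close>;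
  separation of points is not required.
\<close>

definition weak_topology :: "('a \<Rightarrow> 'b \<Rightarrow> real) \<Rightarrow> 'a topology" where
  "weak_topology c = topology_generated_by {(\<lambda>x. c x y) -` U | y U. open U}"

definition dual_topology :: "('a \<Rightarrow> 'b \<Rightarrow> real) \<Rightarrow> ('a \<times> 'b) topology" where
  "dual_topology c = prod_topology (weak_topology c) (weak_topology (\<lambda>y x. c x y))"

definition coupling :: "('a \<Rightarrow> 'b \<Rightarrow> real) \<Rightarrow> 'a \<times> 'b \<Rightarrow> ereal" where
  "coupling c z = ereal (c (fst z) (snd z))"

definition dual_product :: "('a \<Rightarrow> 'b \<Rightarrow> real) \<Rightarrow> 'a \<times> 'b \<Rightarrow> 'a \<times> 'b \<Rightarrow> real" where
  "dual_product c z w = c (fst z) (snd w) + c (fst w) (snd z)"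

definition conjugate :: "('a \<Rightarrow> 'b \<Rightarrow> real) \<Rightarrow> ('a \<times> 'b \<Rightarrow> ereal) \<Rightarrow> 'a \<times> 'b \<Rightarrow> ereal" where
  "conjugate c f z = (SUP w. ereal (dual_product c z w) - f w)"

definition proper :: "('z \<Rightarrow> ereal) \<Rightarrow> bool" where
  "proper f \<longleftrightarrow> (\<exists>z. f z \<noteq> \<infinity>) \<and> (\<forall>z. f z \<noteq> -\<infinity>)"

text \<open>Convexity is convexity of the epigraph, which avoids sums \<open>\<infinity> + (-\<infinity>)\<close>.\<close>

definition ereal_convex :: "('z::real_vector \<Rightarrow> ereal) \<Rightarrow> bool" where
  "ereal_convex f \<longleftrightarrow> convex {(z, r::real). f z \<le> ereal r}"

definition lower_semicontinuous :: "'z topology \<Rightarrow> ('z \<Rightarrow> ereal) \<Rightarrow> bool" where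
  "lower_semicontinuous \<tau> f \<longleftrightarrow> (\<forall>a. openin \<tau> {z \<in> topspace \<tau>. a < f z})"

definition Gamma_dual ::
    "('a::real_vector \<Rightarrow> 'b::real_vector \<Rightarrow> real) \<Rightarrow> ('a \<times> 'b \<Rightarrow> ereal) set" where
  "Gamma_dual c = {f. proper f \<and> ereal_convex f \<and> lower_semicontinuous (dual_topology c) f}"

definition Graph :: "('a \<Rightarrow> 'b set) \<Rightarrow> ('a \<times> 'b) set" where
  "Graph T = {(x, y). y \<in> T x}"

definition fin_monotone ::
    "('a::real_vector \<Rightarrow> 'b \<Rightarrow> real) \<Rightarrow> nat \<Rightarrow> ('a \<Rightarrow> 'b set) \<Rightarrow> bool" where
  "fin_monotone c n T \<longleftrightarrow>
    (\<forall>x y. (\<forall>i\<in>{1..n}. (x i, y i) \<in> Graph T) \<and> x (n + 1) = x 1 \<longrightarrow>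
      0 \<le> (\<Sum>i=1..n. c (x i - x (i + 1)) (y i)))"

definition n_monotone ::
    "('a::real_vector \<Rightarrow> 'b \<Rightarrow> real) \<Rightarrow> enat \<Rightarrow> ('a \<Rightarrow> 'b set) \<Rightarrow> bool" where
  "n_monotone c n T \<longleftrightarrow>
    (case n of enat k \<Rightarrow> fin_monotone c k T | \<infinity> \<Rightarrow> (\<forall>k\<ge>2. fin_monotone c k T))"

definition maximal_n_monotone ::
    "('a::real_vector \<Rightarrow> 'b \<Rightarrow> real) \<Rightarrow> enat \<Rightarrow> ('a \<Rightarrow> 'b set) \<Rightarrow> bool" where
  "maximal_n_monotone c n T \<longleftrightarrow>
    n_monotone c n T \<and> \<not> (\<exists>S. n_monotone c n S \<and> Graph T \<subset> Graph S)"

text \<open>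
  In the Fitzpatrick function below the supremum of the empty set is \<open>-\<infinity>\<close>, and for
  \<open>n = 1\<close> the sum over \<open>i = 2..n\<close> is empty. The value at \<open>n = 0\<close> is irrelevant.
\<close>

definition fin_fitzpatrick ::
    "('a::real_vector \<Rightarrow> 'b \<Rightarrow> real) \<Rightarrow> ('a \<Rightarrow> 'b set) \<Rightarrow> nat \<Rightarrow> 'a \<times> 'b \<Rightarrow> ereal" where
  "fin_fitzpatrick c T n z =
    Sup {ereal (c (fst z - x 1) (y 1) + (\<Sum>i=2..n. c (x (i - 1) - x i) (y i)) + c (x n) (snd z)) | x y.
      \<forall>i\<in>{1..n}. (x i, y i) \<in> Graph T}"

definition fitzpatrick ::
    "('a::real_vector \<Rightarrow> 'b \<Rightarrow> real) \<Rightarrow> ('a \<Rightarrow> 'b set) \<Rightarrow> enat \<Rightarrow> 'a \<times> 'b \<Rightarrow> ereal" where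
  "fitzpatrick c T n z =
    (case n of enat k \<Rightarrow> fin_fitzpatrick c T k z | \<infinity> \<Rightarrow> (SUP k\<in>{1..}. fin_fitzpatrick c T k z))"

definition fitzpatrick_conj ::
    "('a::real_vector \<Rightarrow> 'b \<Rightarrow> real) \<Rightarrow> ('a \<Rightarrow> 'b set) \<Rightarrow> enat \<Rightarrow> 'a \<times> 'b \<Rightarrow> ereal" where
  "fitzpatrick_conj c T n = conjugate c (fitzpatrick c T n)"

text \<open>Subtraction on \<^typ>\<open>enat\<close> satisfies \<open>\<infinity> - 1 = \<infinity>\<close>.\<close>

definition n_representable ::
    "('a::real_vector \<Rightarrow> 'b::real_vector \<Rightarrow> real) \<Rightarrow> enat \<Rightarrow> ('a \<Rightarrow> 'b set) \<Rightarrow> bool" where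
  "n_representable c n T \<longleftrightarrow> n_monotone c n T \<and>
    (\<exists>f\<in>Gamma_dual c.
      (\<forall>z. coupling c z \<le> f z) \<and>
      (\<forall>z. f z \<le> max (fitzpatrick c T (n - 1) z) (fitzpatrick_conj c T (n - 1) z)) \<and>
      Graph T = {z. f z = coupling c z})"

text \<open>For \<open>n = 2\<close> the sum over \<open>i = 2..n - 1\<close> is empty.\<close>

definition fin_cond_C ::
    "('a::real_vector \<Rightarrow> 'b \<Rightarrow> real) \<Rightarrow> ('a \<Rightarrow> 'b set) \<Rightarrow> nat \<Rightarrow> 'a \<Rightarrow> 'b \<Rightarrow> bool" where
  "fin_cond_C c T n x y \<longleftrightarrow>
    (\<exists>u v. (\<forall>i\<in>{1..n - 1}. (u i, v i) \<in> Graph T) \<and>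
      0 \<le> c (x - u 1) (v 1) + (\<Sum>i=2..n - 1. c (u (i - 1) - u i) (v i)) + c (u (n - 1) - x) y)"

definition cond_C ::
    "('a::real_vector \<Rightarrow> 'b \<Rightarrow> real) \<Rightarrow> ('a \<Rightarrow> 'b set) \<Rightarrow> enat \<Rightarrow> 'a \<Rightarrow> 'b \<Rightarrow> bool" where
  "cond_C c T n x y \<longleftrightarrow>
    (case n of enat k \<Rightarrow> fin_cond_C c T k x y | \<infinity> \<Rightarrow> (\<exists>m\<ge>2. fin_cond_C c T m x y))"

end

theory Submission
  imports Defs
begin

text \<open>
  Read a list of points as a path and charge each step from first coordinate \<open>a\<close> to the point
  \<open>p\<close> the amount \<open>\<langle>a - fst p, snd p\<rangle>\<close>.  In this language all notions involved speak about the
  same quantity, the total charge of a closed path: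
  \<^item> \<open>n\<close>-monotonicity says that every closed path of length \<open>n\<close> in the graph has charge \<open>\<le> 0\<close>;
  \<^item> \<open>\<phi>\<^sub>T - c\<close> at \<open>z\<close>, for the index \<open>n - 1\<close>, is the supremum of the charges of the closed paths
    from \<open>z\<close> back to \<open>z\<close> through \<open>n - 1\<close> points of the graph;
  \<^item> the condition \<open>C\<^sub>n(z)\<close> says that one of these paths has charge \<open>\<ge> 0\<close>.

  For \<open>n = \<infinity>\<close>, paths of any positive length are meant.

  With the index \<open>n - 1\<close> understood from now on, \<open>n\<close>-monotonicity of \<open>T\<close> amounts to \<open>\<phi>\<^sub>T \<le> c\<close> on the
  graph; equality then holds there, as the constant path has charge 0.  A point \<open>z\<close> with
  \<open>\<phi>\<^sub>T z \<le> c z\<close> can be added to the graph: a closed path that visits \<open>z\<close>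
  falls apart, at its visits to \<open>z\<close>, into closed paths with a single visit, and those that are
  shorter than \<open>n\<close> can be prolonged at no charge by repeating a point.  So an \<open>n\<close>-monotone \<open>T\<close>
  is maximal exactly if its graph contains \<open>[\<phi>\<^sub>T \<le> c]\<close>, and the first three conditions only differ
  in how they record the equality on the graph.

  As a supremum of continuous affine functions \<open>\<phi>\<^sub>T\<close> lies in \<open>\<Gamma>(Z)\<close>, so it is itself a
  representing function when \<open>T\<close> is maximal.  Conversely, let \<open>f\<close> represent \<open>T\<close> and \<open>\<phi>\<^sub>T \<ge> c\<close>.
  If \<open>\<phi>\<^sub>T z = c z\<close>, then the convex function \<open>\<phi>\<^sub>T\<close> touches \<open>c\<close> from above at \<open>z\<close>; comparing the
  slopes of both at \<open>z\<close> gives \<open>\<psi>\<^sub>T z \<le> c z\<close>.  Thus \<open>f z \<le> max (\<phi>\<^sub>T z) (\<psi>\<^sub>T z) \<le> c z\<close>, that is,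
  \<open>z\<close> lies in the graph.  Finally, \<open>C\<^sub>n\<close> at every point implies \<open>\<phi>\<^sub>T \<ge> c\<close>.  The
  converse could fail only where the supremum is 0 without being attained, and for maximal \<open>T\<close>
  this does not happen: on the graph the constant path attains it, and elsewhere \<open>\<phi>\<^sub>T > c\<close>.
\<close>

section \<open>Charges of paths\<close>

fun path_sum :: "('a::real_vector \<Rightarrow> 'b \<Rightarrow> real) \<Rightarrow> 'a \<Rightarrow> ('a \<times> 'b) list \<Rightarrow> real" where
  "path_sum c a [] = 0"
| "path_sum c a (p # ps) = c (a - fst p) (snd p) + path_sum c (fst p) ps"

text \<open>
  Admitting every positive length for \<open>n = \<infinity>\<close> fits the supremum over all \<open>k \<ge> 1\<close> in \<open>\<phi>\<^sub>T\<close> for the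
  index \<open>\<infinity>\<close>.  With it, the arguments about paths rarely have to distinguish finite \<open>n\<close> from \<open>\<infinity>\<close>.
\<close>

definition paths :: "enat \<Rightarrow> 'p set \<Rightarrow> 'p list set" where
  "paths n G = {ps. ps \<noteq> [] \<and> set ps \<subseteq> G \<and> (n = \<infinity> \<or> n = enat (length ps))}"

lemma path_sum_append_point:
  "path_sum c a (ps @ p # qs) = path_sum c a (ps @ [p]) + path_sum c (fst p) qs"
  by (induction ps arbitrary: a) auto

lemma path_sum_append1:
  "ps \<noteq> [] \<Longrightarrow> path_sum c a (ps @ [p]) = path_sum c a ps + c (fst (last ps) - fst p) (snd p)"
  by (induction ps arbitrary: a) auto

lemma path_sum_eq_sum:
  assumes "1 \<le> k"
  shows "path_sum c a (map (\<lambda>i. (x i, y i)) [1..<Suc k]) =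
    c (a - x 1) (y 1) + (\<Sum>i=2..k. c (x (i - 1) - x i) (y i))"
  using assms
proof (induction k rule: dec_induct)
  case base
  show ?case by simp
next
  case (step k)
  have "map (\<lambda>i. (x i, y i)) [1..<Suc (Suc k)] =
      map (\<lambda>i. (x i, y i)) [1..<Suc k] @ [(x (Suc k), y (Suc k))]"
    using step.hyps by simp
  moreover have "last (map (\<lambda>i. (x i, y i)) [1..<Suc k]) = (x k, y k)"
    using step.hyps by (simp add: last_map)
  moreover have "map (\<lambda>i. (x i, y i)) [1..<Suc k] \<noteq> []"
    using step.hyps by simp
  ultimately show ?case
    using step by (simp add: path_sum_append1 del: upt_Suc)
qed

text \<open>
  The cyclic sum in the definition of monotonicity pairs \<open>y i\<close> with the step to the following
  point, whereas \<open>path_sum\<close> pairs it with the step from the preceding one; hence the path is run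
  through backwards.
\<close>

lemma path_sum_rev_eq_sum:
  assumes "bilinear c"
  shows "path_sum c (x (Suc k)) (rev (map (\<lambda>i. (x i, y i)) [1..<Suc k])) =
    - (\<Sum>i=1..k. c (x i - x (i + 1)) (y i))"
proof (induction k)
  case 0
  show ?case by simp
next
  case (Suc k)
  have "rev (map (\<lambda>i. (x i, y i)) [1..<Suc (Suc k)]) =
      (x (Suc k), y (Suc k)) # rev (map (\<lambda>i. (x i, y i)) [1..<Suc k])"
    by simp
  moreover have "c (x (Suc (Suc k)) - x (Suc k)) (y (Suc k)) =
      - c (x (Suc k) - x (Suc (Suc k))) (y (Suc k))"
    using bilinear_lneg[OF assms, of "x (Suc k) - x (Suc (Suc k))"] by simp
  ultimately show ?case using Suc by simp
qed

lemma list_eq_map_upt: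
  assumes "length ps = k"
  obtains x y where "ps = map (\<lambda>i. (x i, y i)) [1..<Suc k]"
proof
  show "ps = map (\<lambda>i. ((\<lambda>i. fst (ps ! (i - 1))) i, (\<lambda>i. snd (ps ! (i - 1))) i)) [1..<Suc k]"
    using assms by (intro nth_equalityI) (auto simp del: upt_Suc)
qed

lemma in_paths_enat: "1 \<le> k \<Longrightarrow> ps \<in> paths (enat k) G \<longleftrightarrow> set ps \<subseteq> G \<and> length ps = k"
  by (auto simp: paths_def)

lemma paths_infinity: "paths \<infinity> G = (\<Union>k\<in>{1..}. paths (enat k) G)"
  by (force simp: paths_def Suc_le_eq)

lemma one_le_enat_pred: "2 \<le> n \<Longrightarrow> 1 \<le> n - (1::enat)"
  by (cases n) (auto simp: one_enat_def numeral_eq_enat)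

lemma path_snoc:
  assumes "2 \<le> n" "ps \<in> paths (n - 1) G" "z \<in> G"
  shows "ps @ [z] \<in> paths n G"
  using assms by (cases n) (auto simp: paths_def one_enat_def numeral_eq_enat)

lemma constant_path:
  assumes "2 \<le> n" "p \<in> G"
  obtains j where "replicate j p \<in> paths (n - 1) G"
proof (cases n)
  case (enat k)
  then have "replicate (k - 1) p \<in> paths (n - 1) G"
    using assms by (auto simp: paths_def one_enat_def numeral_eq_enat)
  then show ?thesis by (rule that)
next
  case infinity
  then have "replicate 1 p \<in> paths (n - 1) G"
    using assms by (auto simp: paths_def)
  then show ?thesis by (rule that)
qed

lemma path_sum_replicate:
  assumes "bilinear c"
  shows "path_sum c (fst p) (replicate j p @ ps) = path_sum c (fst p) ps"
  by (induction j) (auto simp: bilinear_lzero[OF assms])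

lemma path_sum_constant:
  assumes "bilinear c"
  shows "path_sum c (fst p) (replicate j p @ [p]) = 0"
  using path_sum_replicate[OF assms, of p j "[p]"] by (simp add: bilinear_lzero[OF assms])

section \<open>Monotonicity, Fitzpatrick functions and the condition C in terms of paths\<close>

lemma fin_monotone_iff_paths:
  assumes "bilinear c" "1 \<le> k"
  shows "fin_monotone c k T \<longleftrightarrow>
    (\<forall>ps\<in>paths (enat k) (Graph T). path_sum c (fst (last ps)) ps \<le> 0)"
proof safe
  fix ps assume mono: "fin_monotone c k T" and ps: "ps \<in> paths (enat k) (Graph T)"
  then have len: "length ps = k" and sub: "set ps \<subseteq> Graph T"
    using assms by (auto simp: in_paths_enat)
  obtain x y where rev_ps: "rev ps = map (\<lambda>i. (x i, y i)) [1..<Suc k]"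
    using list_eq_map_upt[of "rev ps" k] len by auto
  define x' where "x' = x(Suc k := x 1)"
  have rev_ps': "rev ps = map (\<lambda>i. (x' i, y i)) [1..<Suc k]"
    unfolding rev_ps x'_def by auto
  then have ps_eq: "ps = rev (map (\<lambda>i. (x' i, y i)) [1..<Suc k])"
    by (metis rev_rev_ident)
  have "hd (rev ps) = (x' 1, y 1)"
    unfolding rev_ps' using assms(2) by (simp add: upt_conv_Cons del: upt_Suc)
  then have last_ps: "fst (last ps) = x' (Suc k)"
    using assms(2) by (simp add: hd_rev x'_def)
  have "\<forall>i\<in>{1..k}. (x' i, y i) \<in> Graph T"
  proof
    fix i assume "i \<in> {1..k}"
    then have "(x' i, y i) \<in> set (rev ps)" unfolding rev_ps' by (auto simp del: upt_Suc)
    then show "(x' i, y i) \<in> Graph T" using sub by auto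
  qed
  moreover have "x' (k + 1) = x' 1" by (simp add: x'_def)
  ultimately have "0 \<le> (\<Sum>i=1..k. c (x' i - x' (i + 1)) (y i))"
    using mono unfolding fin_monotone_def by blast
  then show "path_sum c (fst (last ps)) ps \<le> 0"
    using path_sum_rev_eq_sum[OF assms(1), of x' k y] unfolding last_ps ps_eq[symmetric] by simp
next
  assume *: "\<forall>ps\<in>paths (enat k) (Graph T). path_sum c (fst (last ps)) ps \<le> 0"
  show "fin_monotone c k T"
    unfolding fin_monotone_def
  proof (intro allI impI)
    fix x y assume xy: "(\<forall>i\<in>{1..k}. (x i, y i) \<in> Graph T) \<and> x (k + 1) = x 1"
    let ?ps = "rev (map (\<lambda>i. (x i, y i)) [1..<Suc k])"
    have "?ps \<in> paths (enat k) (Graph T)"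
      using assms(2) xy by (auto simp: in_paths_enat simp del: upt_Suc)
    moreover have "fst (last ?ps) = x (Suc k)"
      using assms(2) xy by (simp add: last_rev upt_conv_Cons del: upt_Suc)
    ultimately have "path_sum c (x (Suc k)) ?ps \<le> 0"
      using * by metis
    then show "0 \<le> (\<Sum>i=1..k. c (x i - x (i + 1)) (y i))"
      unfolding path_sum_rev_eq_sum[OF assms(1)] by simp
  qed
qed

lemma n_monotone_iff_paths:
  assumes "bilinear c" "2 \<le> n"
  shows "n_monotone c n T \<longleftrightarrow> (\<forall>ps\<in>paths n (Graph T). path_sum c (fst (last ps)) ps \<le> 0)"
proof (cases n)
  case (enat k)
  then show ?thesis
    using assms by (simp add: n_monotone_def fin_monotone_iff_paths numeral_eq_enat)
next
  case infinity
  \<comment> \<open>The length 1, which the definition leaves out, only contributes closed paths of charge 0.\<close>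
  have one: "path_sum c (fst (last ps)) ps \<le> 0" if "ps \<in> paths (enat 1) (Graph T)" for ps
    using that by (cases ps) (auto simp: in_paths_enat bilinear_lzero[OF assms(1)])
  have "(\<forall>k\<ge>2. fin_monotone c k T) \<longleftrightarrow>
      (\<forall>k\<ge>1. \<forall>ps\<in>paths (enat k) (Graph T). path_sum c (fst (last ps)) ps \<le> 0)"
  proof (intro iffI allI impI)
    fix k :: nat assume "\<forall>k\<ge>2. fin_monotone c k T" "1 \<le> k"
    then show "\<forall>ps\<in>paths (enat k) (Graph T). path_sum c (fst (last ps)) ps \<le> 0"
      using one fin_monotone_iff_paths[OF assms(1), of k T] by (cases "k = 1") auto
  next
    fix k :: nat
    assume "\<forall>k\<ge>1. \<forall>ps\<in>paths (enat k) (Graph T). path_sum c (fst (last ps)) ps \<le> 0" "2 \<le> k"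
    moreover from \<open>2 \<le> k\<close> have "1 \<le> k" by simp
    ultimately show "fin_monotone c k T"
      using fin_monotone_iff_paths[OF assms(1), of k T] by blast
  qed
  then show ?thesis
    using infinity by (auto simp: n_monotone_def paths_infinity)
qed

text \<open>
  The affine function of \<open>z\<close> under the supremum in the Fitzpatrick function is the charge of the
  closed path through \<open>z\<close>, up to the term \<open>c z\<close>.
\<close>

lemma fitzpatrick_summand_eq:
  assumes "bilinear c" "1 \<le> k"
  shows "c (a - x 1) (y 1) + (\<Sum>i=2..k. c (x (i - 1) - x i) (y i)) + c (x k) b =
    path_sum c a (map (\<lambda>i. (x i, y i)) [1..<Suc k] @ [(a, b)]) + c a b"
proof -
  have "map (\<lambda>i. (x i, y i)) [1..<Suc k] \<noteq> []"
    using assms(2) by simp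
  moreover have "last (map (\<lambda>i. (x i, y i)) [1..<Suc k]) = (x k, y k)"
    using assms(2) by (simp add: last_map)
  ultimately have "path_sum c a (map (\<lambda>i. (x i, y i)) [1..<Suc k] @ [(a, b)]) =
      c (a - x 1) (y 1) + (\<Sum>i=2..k. c (x (i - 1) - x i) (y i)) + c (x k - a) b"
    using path_sum_eq_sum[OF assms(2), of c a x y] by (simp add: path_sum_append1 del: upt_Suc)
  then show ?thesis
    by (simp add: bilinear_lsub[OF assms(1)])
qed

lemma fin_fitzpatrick_eq_SUP:
  assumes "bilinear c" "1 \<le> k"
  shows "fin_fitzpatrick c T k z =
    (SUP ps\<in>paths (enat k) (Graph T).
      ereal (path_sum c (fst z) (ps @ [z]) + c (fst z) (snd z)))"
proof -
  have "{ereal (c (fst z - x 1) (y 1) + (\<Sum>i=2..k. c (x (i - 1) - x i) (y i)) + c (x k) (snd z))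
        | x y. \<forall>i\<in>{1..k}. (x i, y i) \<in> Graph T} =
      (\<lambda>ps. ereal (path_sum c (fst z) (ps @ [z]) + c (fst z) (snd z))) ` paths (enat k) (Graph T)"
    (is "?A = ?f ` ?P")
  proof (intro equalityI subsetI)
    fix r assume "r \<in> ?A"
    then obtain x y where xy: "\<forall>i\<in>{1..k}. (x i, y i) \<in> Graph T"
      and r: "r = ereal (c (fst z - x 1) (y 1) + (\<Sum>i=2..k. c (x (i - 1) - x i) (y i))
        + c (x k) (snd z))"
      by blast
    have "r = ?f (map (\<lambda>i. (x i, y i)) [1..<Suc k])"
      unfolding r fitzpatrick_summand_eq[OF assms] by (simp del: upt_Suc)
    moreover have "map (\<lambda>i. (x i, y i)) [1..<Suc k] \<in> ?P"
      using xy assms(2) by (auto simp: in_paths_enat simp del: upt_Suc)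
    ultimately show "r \<in> ?f ` ?P" by blast
  next
    fix r assume "r \<in> ?f ` ?P"
    then obtain ps where ps: "ps \<in> ?P" and r: "r = ?f ps" by blast
    obtain x y where ps_eq: "ps = map (\<lambda>i. (x i, y i)) [1..<Suc k]"
      using list_eq_map_upt[of ps k] ps assms(2) by (auto simp: in_paths_enat)
    have "\<forall>i\<in>{1..k}. (x i, y i) \<in> Graph T"
      using ps assms(2) unfolding ps_eq by (auto simp: in_paths_enat simp del: upt_Suc)
    moreover have "r = ereal (c (fst z - x 1) (y 1) + (\<Sum>i=2..k. c (x (i - 1) - x i) (y i))
        + c (x k) (snd z))"
      unfolding r ps_eq fitzpatrick_summand_eq[OF assms] by (simp del: upt_Suc)
    ultimately show "r \<in> ?A" by blast
  qed
  then show ?thesis unfolding fin_fitzpatrick_def by simp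
qed

lemma fitzpatrick_eq_SUP:
  assumes "bilinear c" "1 \<le> m"
  shows "fitzpatrick c T m z =
    (SUP ps\<in>paths m (Graph T). ereal (path_sum c (fst z) (ps @ [z]) + c (fst z) (snd z)))"
proof (cases m)
  case (enat k)
  then show ?thesis
    using assms by (simp add: fitzpatrick_def fin_fitzpatrick_eq_SUP one_enat_def)
next
  case infinity
  then show ?thesis
    using assms(1)
    by (simp add: fitzpatrick_def fin_fitzpatrick_eq_SUP paths_infinity SUP_UNION cong: SUP_cong_simp)
qed

lemma fitzpatrick_le_coupling_iff:
  assumes "bilinear c" "1 \<le> m"
  shows "fitzpatrick c T m z \<le> coupling c z \<longleftrightarrow>
    (\<forall>ps\<in>paths m (Graph T). path_sum c (fst z) (ps @ [z]) \<le> 0)"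
  unfolding fitzpatrick_eq_SUP[OF assms] coupling_def by (simp add: SUP_le_iff)

lemma coupling_less_fitzpatrick_iff:
  assumes "bilinear c" "1 \<le> m"
  shows "coupling c z < fitzpatrick c T m z \<longleftrightarrow>
    (\<exists>ps\<in>paths m (Graph T). 0 < path_sum c (fst z) (ps @ [z]))"
  unfolding fitzpatrick_eq_SUP[OF assms] coupling_def by (simp add: less_SUP_iff)

lemma coupling_le_fitzpatrickI:
  assumes "bilinear c" "1 \<le> m" "ps \<in> paths m (Graph T)" "0 \<le> path_sum c (fst z) (ps @ [z])"
  shows "coupling c z \<le> fitzpatrick c T m z"
  unfolding fitzpatrick_eq_SUP[OF assms(1,2)] coupling_def
  using assms(4) by (intro SUP_upper2[OF assms(3)]) simp

lemma fin_cond_C_iff_path: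
  assumes "bilinear c" "2 \<le> n"
  shows "fin_cond_C c T n x y \<longleftrightarrow>
    (\<exists>ps\<in>paths (enat (n - 1)) (Graph T). 0 \<le> path_sum c x (ps @ [(x, y)]))"
proof -
  have k: "1 \<le> n - 1" using assms(2) by simp
  have charge: "path_sum c x (map (\<lambda>i. (u i, v i)) [1..<Suc (n - 1)] @ [(x, y)]) =
      c (x - u 1) (v 1) + (\<Sum>i=2..n - 1. c (u (i - 1) - u i) (v i)) + c (u (n - 1) - x) y" for u v
    using fitzpatrick_summand_eq[OF assms(1) k, of x u v y] by (simp add: bilinear_lsub[OF assms(1)])
  show ?thesis
  proof
    assume "fin_cond_C c T n x y"
    then obtain u v where uv: "\<forall>i\<in>{1..n - 1}. (u i, v i) \<in> Graph T"
      and "0 \<le> c (x - u 1) (v 1) + (\<Sum>i=2..n - 1. c (u (i - 1) - u i) (v i)) + c (u (n - 1) - x) y"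
      unfolding fin_cond_C_def by blast
    then have "0 \<le> path_sum c x (map (\<lambda>i. (u i, v i)) [1..<Suc (n - 1)] @ [(x, y)])"
      unfolding charge by simp
    moreover have "map (\<lambda>i. (u i, v i)) [1..<Suc (n - 1)] \<in> paths (enat (n - 1)) (Graph T)"
      using uv k by (auto simp: in_paths_enat simp del: upt_Suc)
    ultimately show "\<exists>ps\<in>paths (enat (n - 1)) (Graph T). 0 \<le> path_sum c x (ps @ [(x, y)])"
      by blast
  next
    assume "\<exists>ps\<in>paths (enat (n - 1)) (Graph T). 0 \<le> path_sum c x (ps @ [(x, y)])"
    then obtain ps where ps: "ps \<in> paths (enat (n - 1)) (Graph T)"
      and le: "0 \<le> path_sum c x (ps @ [(x, y)])" by blast
    obtain u v where ps_eq: "ps = map (\<lambda>i. (u i, v i)) [1..<Suc (n - 1)]"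
      using list_eq_map_upt[of ps "n - 1"] ps k by (auto simp: in_paths_enat)
    have "\<forall>i\<in>{1..n - 1}. (u i, v i) \<in> Graph T"
      using ps k unfolding ps_eq by (auto simp: in_paths_enat image_subset_iff simp del: upt_Suc)
    then show "fin_cond_C c T n x y"
      using le unfolding ps_eq charge fin_cond_C_def by blast
  qed
qed

lemma cond_C_iff_path:
  assumes "bilinear c" "2 \<le> n"
  shows "cond_C c T n x y \<longleftrightarrow>
    (\<exists>ps\<in>paths (n - 1) (Graph T). 0 \<le> path_sum c x (ps @ [(x, y)]))"
proof (cases n)
  case (enat k)
  then show ?thesis
    using assms by (simp add: cond_C_def fin_cond_C_iff_path numeral_eq_enat one_enat_def)
next
  case infinity
  have "(\<exists>m\<ge>2. fin_cond_C c T m x y) \<longleftrightarrow>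
      (\<exists>k\<ge>1. \<exists>ps\<in>paths (enat k) (Graph T). 0 \<le> path_sum c x (ps @ [(x, y)]))"
    (is "?L \<longleftrightarrow> ?R")
  proof
    assume ?L
    then obtain m where "2 \<le> m" "fin_cond_C c T m x y" by blast
    then show ?R
      using fin_cond_C_iff_path[OF assms(1), of m T x y] by (intro exI[of _ "m - 1"]) auto
  next
    assume ?R
    then obtain k where "1 \<le> k"
      "\<exists>ps\<in>paths (enat k) (Graph T). 0 \<le> path_sum c x (ps @ [(x, y)])" by blast
    then show ?L
      using fin_cond_C_iff_path[OF assms(1), of "Suc k" T x y] by (intro exI[of _ "Suc k"]) auto
  qed
  then show ?thesis
    using infinity by (auto simp: cond_C_def paths_infinity)
qed

section \<open>Enlarging the graph\<close>

text \<open>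
  A path through \<open>G\<close> from \<open>z\<close> to \<open>z\<close> is prolonged to an admitted length by repeating its first
  point, which costs nothing.
\<close>

lemma pad_path:
  assumes "bilinear c" "ps \<noteq> []" "set ps \<subseteq> G" "enat (length ps) \<le> m"
  obtains qs where "qs \<in> paths m G" "path_sum c a (qs @ [z]) = path_sum c a (ps @ [z])"
proof (cases m)
  case (enat k)
  obtain p rest where ps: "ps = p # rest" using assms(2) by (cases ps) auto
  define qs where "qs = p # replicate (k - length ps) p @ rest"
  have "qs \<in> paths m G"
    using assms enat ps by (auto simp: qs_def paths_def)
  moreover have "path_sum c a (qs @ [z]) = path_sum c a (ps @ [z])"
    using path_sum_replicate[OF assms(1), of p _ "rest @ [z]"] by (simp add: qs_def ps)
  ultimately show ?thesis by (rule that)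
next
  case infinity
  then have "ps \<in> paths m G" using assms by (auto simp: paths_def)
  then show ?thesis by (rule that) simp
qed

text \<open>
  Cutting at the visits to \<open>z\<close> reduces a closed path at \<open>z\<close> through \<open>insert z G\<close> to closed paths at
  \<open>z\<close> through \<open>G\<close>; those that are too short are padded, unless they stay at \<open>z\<close> at no charge.
\<close>

lemma path_sum_insert_le_0:
  assumes "bilinear c"
    and G: "\<And>ps. ps \<in> paths m G \<Longrightarrow> path_sum c (fst z) (ps @ [z]) \<le> 0"
    and "set qs \<subseteq> insert z G" "enat (length qs) \<le> m"
  shows "path_sum c (fst z) (qs @ [z]) \<le> 0"
  using assms(3,4)
proof (induction "length qs" arbitrary: qs rule: less_induct)
  case less
  show ?case
  proof (cases "z \<in> set qs")
    case True
    then obtain us vs where qs: "qs = us @ z # vs" by (meson split_list)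
    have "enat (length us) \<le> enat (length qs)" "enat (length vs) \<le> enat (length qs)"
      by (auto simp: qs)
    then have len: "enat (length us) \<le> m" "enat (length vs) \<le> m"
      using less.prems(2) by (blast intro: order_trans)+
    have "path_sum c (fst z) (us @ [z]) \<le> 0" "path_sum c (fst z) (vs @ [z]) \<le> 0"
      using less.prems(1) len by (auto intro!: less.hyps simp: qs)
    then show ?thesis
      using path_sum_append_point[of c "fst z" us z "vs @ [z]"] by (simp add: qs)
  next
    case False
    show ?thesis
    proof (cases "qs = []")
      case True
      then show ?thesis by (simp add: bilinear_lzero[OF assms(1)])
    next
      case nonempty: False
      have "set qs \<subseteq> G" using less.prems(1) False by auto
      then obtain ps where "ps \<in> paths m G"
        "path_sum c (fst z) (ps @ [z]) = path_sum c (fst z) (qs @ [z])"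
        using pad_path[OF assms(1) nonempty _ less.prems(2)] by metis
      then show ?thesis using G[of ps] by simp
    qed
  qed
qed

lemma closed_path_sum_insert_le_0:
  assumes "bilinear c" "2 \<le> n"
    and G: "\<And>ps. ps \<in> paths n G \<Longrightarrow> path_sum c (fst (last ps)) ps \<le> 0"
    and z: "\<And>ps. ps \<in> paths (n - 1) G \<Longrightarrow> path_sum c (fst z) (ps @ [z]) \<le> 0"
    and ps: "ps \<in> paths n (insert z G)"
  shows "path_sum c (fst (last ps)) ps \<le> 0"
proof (cases "z \<in> set ps")
  case True
  then obtain us vs where split: "ps = us @ z # vs" by (meson split_list)
  \<comment> \<open>Rotate the closed path so that it starts and ends at \<open>z\<close>.\<close>
  have "path_sum c (fst (last ps)) ps = path_sum c (fst z) ((vs @ us) @ [z])"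
  proof (cases vs rule: rev_cases)
    case Nil
    then show ?thesis by (simp add: split)
  next
    case (snoc ws w)
    have "path_sum c (fst (last ps)) ps = path_sum c (fst w) (us @ [z]) + path_sum c (fst z) vs"
      using path_sum_append_point[of c "fst w" us z vs] by (simp add: split snoc)
    also have "\<dots> = path_sum c (fst z) (vs @ us @ [z])"
      using path_sum_append_point[of c "fst z" ws w "us @ [z]"] by (simp add: snoc)
    finally show ?thesis by simp
  qed
  moreover have "path_sum c (fst z) ((vs @ us) @ [z]) \<le> 0"
  proof (rule path_sum_insert_le_0[OF assms(1) z])
    show "set (vs @ us) \<subseteq> insert z G"
      using ps by (auto simp: paths_def split)
    show "enat (length (vs @ us)) \<le> n - 1"
      using ps by (cases n) (auto simp: paths_def split one_enat_def)
  qed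
  ultimately show ?thesis by simp
next
  case False
  then have "ps \<in> paths n G" using ps by (auto simp: paths_def)
  then show ?thesis by (rule G)
qed

lemma n_monotone_insert:
  assumes "bilinear c" "2 \<le> n" "n_monotone c n T" "fitzpatrick c T (n - 1) z \<le> coupling c z"
    and S: "Graph S = insert z (Graph T)"
  shows "n_monotone c n S"
proof -
  note m = one_le_enat_pred[OF assms(2)]
  show ?thesis
    using assms closed_path_sum_insert_le_0[OF assms(1,2), of "Graph T" z]
    unfolding n_monotone_iff_paths[OF assms(1,2)] fitzpatrick_le_coupling_iff[OF assms(1) m] S
    by blast
qed

section \<open>The Fitzpatrick function is convex and lower semicontinuous\<close>

text \<open>
  The term \<open>c z\<close> cancels against the last step of the path, which leaves a constant and a linear
  part.  The constant does not involve \<open>z\<close>: it is the charge of the path when started at 0.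
\<close>

lemma closed_path_sum_affine:
  assumes "bilinear c" "ps \<noteq> []"
  shows "path_sum c (fst z) (ps @ [z]) + c (fst z) (snd z) =
    c (fst z) (snd (hd ps)) + c (fst (last ps)) (snd z) + path_sum c 0 ps"
proof -
  obtain p rest where "ps = p # rest" using assms(2) by (cases ps) auto
  then have "path_sum c (fst z) ps = c (fst z) (snd (hd ps)) + path_sum c 0 ps"
    using bilinear_lsub[OF assms(1), of 0 "fst p"] bilinear_lzero[OF assms(1)]
    by (simp add: bilinear_lsub[OF assms(1)])
  then show ?thesis
    using path_sum_append1[OF assms(2)] by (simp add: bilinear_lsub[OF assms(1)])
qed

lemma ereal_convex_SUP_affine:
  fixes g :: "'i \<Rightarrow> 'z::real_vector \<Rightarrow> real"
  assumes "\<And>i. i \<in> I \<Longrightarrow> linear (g i)"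
  shows "ereal_convex (\<lambda>z. SUP i\<in>I. ereal (g i z + k i))"
proof -
  have "convex {(z, r::real). g i z + k i \<le> r}" if "i \<in> I" for i
  proof -
    have "linear (\<lambda>p::'z \<times> real. g i (fst p) - snd p)"
      using linear_compose[OF linear_fst assms[OF that], unfolded o_def]
      by (intro linear_compose_sub linear_snd)
    then have "convex ((\<lambda>p. g i (fst p) - snd p) -` {..- k i})"
      by (intro convex_linear_vimage) auto
    moreover have "(\<lambda>p. g i (fst p) - snd p) -` {..- k i} = {(z, r). g i z + k i \<le> r}"
      by auto
    ultimately show ?thesis by simp
  qed
  then have "convex (\<Inter>i\<in>I. {(z, r::real). g i z + k i \<le> r})"
    by (intro convex_INT)
  moreover have "(\<Inter>i\<in>I. {(z, r::real). g i z + k i \<le> r}) =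
      {(z, r). (SUP i\<in>I. ereal (g i z + k i)) \<le> ereal r}"
    by (auto simp: SUP_le_iff)
  ultimately show ?thesis by (simp add: ereal_convex_def)
qed

lemma lower_semicontinuous_SUP:
  assumes "\<And>i. i \<in> I \<Longrightarrow> continuous_map \<tau> euclideanreal (g i)"
  shows "lower_semicontinuous \<tau> (\<lambda>z. SUP i\<in>I. ereal (g i z))"
  unfolding lower_semicontinuous_def
proof
  fix a :: ereal
  have "open {r. a < ereal r}"
    using open_vimage[OF open_greaterThan[of a] continuous_on_ereal[OF continuous_on_id]]
    by (simp add: vimage_def)
  then have "openin \<tau> {z \<in> topspace \<tau>. a < ereal (g i z)}" if "i \<in> I" for i
    using openin_continuous_map_preimage[OF assms[OF that], of "{r. a < ereal r}"] by simp
  then have "openin \<tau> (\<Union>i\<in>I. {z \<in> topspace \<tau>. a < ereal (g i z)})"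
    by blast
  moreover have "(\<Union>i\<in>I. {z \<in> topspace \<tau>. a < ereal (g i z)}) =
      {z \<in> topspace \<tau>. a < (SUP i\<in>I. ereal (g i z))}"
    by (auto simp: less_SUP_iff)
  ultimately show "openin \<tau> {z \<in> topspace \<tau>. a < (SUP i\<in>I. ereal (g i z))}" by simp
qed

lemma continuous_map_weak_topology:
  "continuous_map (weak_topology c) euclideanreal (\<lambda>x. c x y)"
proof -
  have generator: "openin (weak_topology c) ((\<lambda>x. c x y) -` U)" if "open U" for U
    unfolding weak_topology_def using that by (intro topology_generated_by_Basis) blast
  have "topspace (weak_topology c) = UNIV"
    using openin_subset[OF generator[OF open_UNIV]] by auto
  then show ?thesis
    using generator by (auto simp: continuous_map vimage_def)
qed

lemma continuous_map_dual_topology: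
  "continuous_map (dual_topology c) euclideanreal (\<lambda>z. c (fst z) y + c x (snd z) + k)"
proof -
  have "continuous_map (dual_topology c) euclideanreal (\<lambda>z. c (fst z) y)"
    using continuous_map_compose[OF continuous_map_fst continuous_map_weak_topology[of c y]]
    by (simp add: dual_topology_def o_def)
  moreover have "continuous_map (dual_topology c) euclideanreal (\<lambda>z. c x (snd z))"
    using continuous_map_compose[OF continuous_map_snd continuous_map_weak_topology[of "\<lambda>y x. c x y" x]]
    by (simp add: dual_topology_def o_def)
  ultimately show ?thesis
    by (intro continuous_map_add continuous_map_const[THEN iffD2]) auto
qed

lemma fitzpatrick_eq_SUP_affine:
  assumes "bilinear c" "1 \<le> m"
  shows "fitzpatrick c T m = (\<lambda>z. SUP ps\<in>paths m (Graph T).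
    ereal (c (fst z) (snd (hd ps)) + c (fst (last ps)) (snd z) + path_sum c 0 ps))"
proof
  fix z
  show "fitzpatrick c T m z = (SUP ps\<in>paths m (Graph T).
      ereal (c (fst z) (snd (hd ps)) + c (fst (last ps)) (snd z) + path_sum c 0 ps))"
    unfolding fitzpatrick_eq_SUP[OF assms]
    by (intro SUP_cong refl arg_cong[of _ _ ereal] closed_path_sum_affine[OF assms(1)])
      (simp add: paths_def)
qed

lemma ereal_convex_fitzpatrick:
  assumes "bilinear c" "1 \<le> m"
  shows "ereal_convex (fitzpatrick c T m)"
  unfolding fitzpatrick_eq_SUP_affine[OF assms]
proof (rule ereal_convex_SUP_affine)
  fix ps :: "('a \<times> 'b) list"
  have "linear (\<lambda>x. c x y)" "linear (c x)" for x y
    using assms(1) by (auto simp: bilinear_def)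
  then show "linear (\<lambda>z. c (fst z) (snd (hd ps)) + c (fst (last ps)) (snd z))"
    using linear_compose[OF linear_fst, unfolded o_def] linear_compose[OF linear_snd, unfolded o_def]
    by (intro linear_compose_add) blast+
qed

lemma lower_semicontinuous_fitzpatrick:
  assumes "bilinear c" "1 \<le> m"
  shows "lower_semicontinuous (dual_topology c) (fitzpatrick c T m)"
  unfolding fitzpatrick_eq_SUP_affine[OF assms]
  by (intro lower_semicontinuous_SUP continuous_map_dual_topology)

section \<open>Convex majorants of the coupling\<close>

lemma coupling_line:
  assumes "bilinear c"
  shows "c (fst ((1 - t) *\<^sub>R z + t *\<^sub>R w)) (snd ((1 - t) *\<^sub>R z + t *\<^sub>R w)) =
    (1 - t)\<^sup>2 * c (fst z) (snd z) + t * (1 - t) * dual_product c z w + t\<^sup>2 * c (fst w) (snd w)"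
  by (simp add: bilinear_ladd[OF assms] bilinear_radd[OF assms] bilinear_lmul[OF assms]
      bilinear_rmul[OF assms] dual_product_def) (simp add: power2_eq_square algebra_simps)

text \<open>
  On the segment from \<open>z\<close> to \<open>w\<close> the function \<open>h\<close> lies below its chord and above the quadratic
  \<open>c\<close>, with equality at \<open>z\<close>.  So the slope \<open>h w - c z\<close> of the chord is at least the slope
  \<open>dual_product c z w - 2 * c z\<close> of \<open>c\<close> at \<open>z\<close>.
\<close>

lemma conjugate_le_coupling_of_touching:
  assumes "bilinear c" "ereal_convex h" "\<And>w. coupling c w \<le> h w" "h z = coupling c z"
  shows "conjugate c h z \<le> coupling c z"
  unfolding conjugate_def
proof (rule SUP_least)
  fix w
  show "ereal (dual_product c z w) - h w \<le> coupling c z"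
  proof (cases "h w")
    case (real r)
    define p q d where "p = c (fst z) (snd z)" "q = c (fst w) (snd w)" "d = dual_product c z w"
    have slope: "(1 - t) * (d - p) + t * q \<le> r" if "t \<in> {0<..<1}" for t
    proof -
      have t: "0 < t" "t < 1" using that by auto
      have "convex {(z, r::real). h z \<le> ereal r}"
        using assms(2) by (simp add: ereal_convex_def)
      moreover have "(z, p) \<in> {(z, r::real). h z \<le> ereal r}" "(w, r) \<in> {(z, r::real). h z \<le> ereal r}"
        using real assms(4) by (auto simp: coupling_def p_q_d_def)
      ultimately have "(1 - t) *\<^sub>R (z, p) + t *\<^sub>R (w, r) \<in> {(z, r::real). h z \<le> ereal r}"
        using t by (intro convexD) auto
      then have "h ((1 - t) *\<^sub>R z + t *\<^sub>R w) \<le> ereal ((1 - t) * p + t * r)"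
        by (simp del: ereal_less_eq)
      then have "(1 - t)\<^sup>2 * p + t * (1 - t) * d + t\<^sup>2 * q \<le> (1 - t) * p + t * r"
        using order_trans[OF assms(3)] coupling_line[OF assms(1), of t z w]
        by (fastforce simp: coupling_def p_q_d_def)
      then have "t * ((1 - t) * (d - p) + t * q) \<le> t * r"
        by (simp add: power2_eq_square algebra_simps)
      then show ?thesis using t by simp
    qed
    \<comment> \<open>The slope of \<open>c\<close> at \<open>z\<close> appears in the limit \<open>t \<longlongrightarrow> 0\<close>.\<close>
    have "((\<lambda>t. (1 - t) * (d - p) + t * q) \<longlongrightarrow> (1 - 0) * (d - p) + 0 * q) (at_right 0)"
      by (intro tendsto_intros)
    moreover have "eventually (\<lambda>t. (1 - t) * (d - p) + t * q \<le> r) (at_right 0)"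
      using slope by (intro eventually_at_rightI[of 0 1]) auto
    ultimately have "(1 - 0) * (d - p) + 0 * q \<le> r"
      by (intro tendsto_upperbound) auto
    then show ?thesis using real by (simp add: coupling_def p_q_d_def)
  next
    case PInf
    then show ?thesis by simp
  next
    case MInf
    then show ?thesis using assms(3)[of w] by (simp add: coupling_def)
  qed
qed

section \<open>Characterizations of maximality\<close>

lemma fitzpatrick_eq_coupling_on_Graph:
  assumes "bilinear c" "2 \<le> n" "n_monotone c n T" "z \<in> Graph T"
  shows "fitzpatrick c T (n - 1) z = coupling c z"
proof (rule antisym)
  note m = one_le_enat_pred[OF assms(2)]
  show "fitzpatrick c T (n - 1) z \<le> coupling c z"
    unfolding fitzpatrick_le_coupling_iff[OF assms(1) m]
  proof
    fix ps assume "ps \<in> paths (n - 1) (Graph T)"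
    then have "ps @ [z] \<in> paths n (Graph T)"
      by (rule path_snoc[OF assms(2) _ assms(4)])
    then have "path_sum c (fst (last (ps @ [z]))) (ps @ [z]) \<le> 0"
      using assms(3) unfolding n_monotone_iff_paths[OF assms(1,2)] by blast
    then show "path_sum c (fst z) (ps @ [z]) \<le> 0" by simp
  qed
  obtain j where "replicate j z \<in> paths (n - 1) (Graph T)"
    using constant_path[OF assms(2,4)] .
  then show "coupling c z \<le> fitzpatrick c T (n - 1) z"
    by (rule coupling_le_fitzpatrickI[OF assms(1) m]) (simp add: path_sum_constant[OF assms(1)])
qed

lemma n_monotone_if_fitzpatrick_le_coupling:
  assumes "bilinear c" "2 \<le> n" "\<And>z. z \<in> Graph T \<Longrightarrow> fitzpatrick c T (n - 1) z \<le> coupling c z"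
  shows "n_monotone c n T"
  unfolding n_monotone_iff_paths[OF assms(1,2)]
proof
  note m = one_le_enat_pred[OF assms(2)]
  fix ps assume ps: "ps \<in> paths n (Graph T)"
  then obtain qs z where split: "ps = qs @ [z]"
    by (cases ps rule: rev_cases) (auto simp: paths_def)
  show "path_sum c (fst (last ps)) ps \<le> 0"
  proof (cases "qs = []")
    case True
    then show ?thesis by (simp add: split bilinear_lzero[OF assms(1)])
  next
    case False
    then have "qs \<in> paths (n - 1) (Graph T)" "z \<in> Graph T"
      using ps by (cases n; auto simp: paths_def split one_enat_def)+
    then show ?thesis
      using assms(3) unfolding fitzpatrick_le_coupling_iff[OF assms(1) m] by (simp add: split)
  qed
qed

lemma maximal_n_monotone_iff_subset:
  assumes "bilinear c" "2 \<le> n"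
  shows "maximal_n_monotone c n T \<longleftrightarrow>
    n_monotone c n T \<and> {z. fitzpatrick c T (n - 1) z \<le> coupling c z} \<subseteq> Graph T"
proof -
  note m = one_le_enat_pred[OF assms(2)]
  show ?thesis
  proof (intro iffI conjI subsetI)
    assume "maximal_n_monotone c n T"
    then show "n_monotone c n T" by (simp add: maximal_n_monotone_def)
  next
    fix z assume max: "maximal_n_monotone c n T" and "z \<in> {z. fitzpatrick c T (n - 1) z \<le> coupling c z}"
    then have z: "fitzpatrick c T (n - 1) z \<le> coupling c z" and mono: "n_monotone c n T"
      by (auto simp: maximal_n_monotone_def)
    define S where "S = (\<lambda>x. {y. (x, y) \<in> insert z (Graph T)})"
    have S: "Graph S = insert z (Graph T)" by (auto simp: S_def Graph_def)
    have "n_monotone c n S" by (rule n_monotone_insert[OF assms mono z S])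
    then have "\<not> Graph T \<subset> Graph S" using max by (auto simp: maximal_n_monotone_def)
    then show "z \<in> Graph T" using S by blast
  next
    assume *: "n_monotone c n T \<and> {z. fitzpatrick c T (n - 1) z \<le> coupling c z} \<subseteq> Graph T"
    have False if "n_monotone c n S" and less: "Graph T \<subset> Graph S" for S
    proof -
      obtain w where w: "w \<in> Graph S" "w \<notin> Graph T" using less by blast
      have "fitzpatrick c S (n - 1) w \<le> coupling c w"
        using fitzpatrick_eq_coupling_on_Graph[OF assms that(1) w(1)] by simp
      moreover have "paths (n - 1) (Graph T) \<subseteq> paths (n - 1) (Graph S)"
        using less by (auto simp: paths_def)
      ultimately have "fitzpatrick c T (n - 1) w \<le> coupling c w"
        unfolding fitzpatrick_le_coupling_iff[OF assms(1) m] by blast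
      then show False using * w by blast
    qed
    then show "maximal_n_monotone c n T"
      using * by (auto simp: maximal_n_monotone_def)
  qed
qed

lemma maximal_n_monotone_iff_Graph_eq:
  assumes "bilinear c" "2 \<le> n"
  shows "maximal_n_monotone c n T \<longleftrightarrow>
    Graph T = {z. fitzpatrick c T (n - 1) z \<le> coupling c z}"
proof
  assume "maximal_n_monotone c n T"
  then have mono: "n_monotone c n T"
    and sub: "{z. fitzpatrick c T (n - 1) z \<le> coupling c z} \<subseteq> Graph T"
    by (auto simp: maximal_n_monotone_iff_subset[OF assms])
  have "fitzpatrick c T (n - 1) z \<le> coupling c z" if "z \<in> Graph T" for z
    using fitzpatrick_eq_coupling_on_Graph[OF assms mono that] by simp
  then show "Graph T = {z. fitzpatrick c T (n - 1) z \<le> coupling c z}"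
    using sub by blast
next
  assume eq: "Graph T = {z. fitzpatrick c T (n - 1) z \<le> coupling c z}"
  then have "n_monotone c n T"
    by (intro n_monotone_if_fitzpatrick_le_coupling[OF assms]) blast
  then show "maximal_n_monotone c n T"
    using eq by (simp add: maximal_n_monotone_iff_subset[OF assms])
qed

lemma maximal_n_monotone_iff_Graph_eq_equality_set:
  assumes "bilinear c" "2 \<le> n"
  shows "maximal_n_monotone c n T \<longleftrightarrow>
    (\<forall>z. coupling c z \<le> fitzpatrick c T (n - 1) z) \<and>
    Graph T = {z. fitzpatrick c T (n - 1) z = coupling c z}"
proof
  assume max: "maximal_n_monotone c n T"
  then have mono: "n_monotone c n T"
    and sub: "{z. fitzpatrick c T (n - 1) z \<le> coupling c z} \<subseteq> Graph T"
    by (auto simp: maximal_n_monotone_iff_subset[OF assms])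
  have on_Graph: "fitzpatrick c T (n - 1) z = coupling c z" if "z \<in> Graph T" for z
    by (rule fitzpatrick_eq_coupling_on_Graph[OF assms mono that])
  have "coupling c z \<le> fitzpatrick c T (n - 1) z" for z
    using sub on_Graph[of z] by (cases "fitzpatrick c T (n - 1) z \<le> coupling c z") auto
  moreover have "Graph T = {z. fitzpatrick c T (n - 1) z = coupling c z}"
    using sub on_Graph by auto
  ultimately show "(\<forall>z. coupling c z \<le> fitzpatrick c T (n - 1) z) \<and>
      Graph T = {z. fitzpatrick c T (n - 1) z = coupling c z}"
    by blast
next
  assume *: "(\<forall>z. coupling c z \<le> fitzpatrick c T (n - 1) z) \<and>
      Graph T = {z. fitzpatrick c T (n - 1) z = coupling c z}"
  then have "Graph T = {z. fitzpatrick c T (n - 1) z \<le> coupling c z}"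
    by (auto intro: antisym)
  then show "maximal_n_monotone c n T"
    by (simp add: maximal_n_monotone_iff_Graph_eq[OF assms])
qed

lemma maximal_n_monotone_imp_Graph_nonempty:
  assumes "bilinear c" "2 \<le> n" "maximal_n_monotone c n T"
  shows "Graph T \<noteq> {}"
proof
  note m = one_le_enat_pred[OF assms(2)]
  assume empty: "Graph T = {}"
  \<comment> \<open>Without points there are no paths, so the Fitzpatrick function is \<open>-\<infinity>\<close> everywhere.\<close>
  then have "paths (n - 1) (Graph T) = {}" by (auto simp: paths_def)
  then have "fitzpatrick c T (n - 1) z \<le> coupling c z" for z
    by (simp add: fitzpatrick_le_coupling_iff[OF assms(1) m])
  then show False
    using assms(3) empty by (auto simp: maximal_n_monotone_iff_subset[OF assms(1,2)])
qed

lemma maximal_n_monotone_imp_n_representable: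
  assumes "bilinear c" "2 \<le> n" "maximal_n_monotone c n T"
  shows "n_representable c n T"
proof -
  note m = one_le_enat_pred[OF assms(2)]
  let ?f = "fitzpatrick c T (n - 1)"
  have ge: "\<And>z. coupling c z \<le> ?f z"
    and eq: "Graph T = {z. ?f z = coupling c z}"
    using assms(3) by (auto simp: maximal_n_monotone_iff_Graph_eq_equality_set[OF assms(1,2)])
  obtain w where "w \<in> Graph T"
    using maximal_n_monotone_imp_Graph_nonempty[OF assms] by blast
  then have "?f w \<noteq> \<infinity>" using eq by (auto simp: coupling_def)
  moreover have "?f z \<noteq> -\<infinity>" for z using ge[of z] by (auto simp: coupling_def)
  ultimately have "proper ?f" unfolding proper_def by blast
  then have "?f \<in> Gamma_dual c"
    using ereal_convex_fitzpatrick[OF assms(1) m] lower_semicontinuous_fitzpatrick[OF assms(1) m]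
    by (simp add: Gamma_dual_def)
  moreover have "n_monotone c n T" using assms(3) by (simp add: maximal_n_monotone_def)
  ultimately show ?thesis
    unfolding n_representable_def using ge eq by (intro conjI bexI[of _ ?f]) auto
qed

lemma n_representable_imp_maximal_n_monotone:
  assumes "bilinear c" "2 \<le> n" "\<And>z. coupling c z \<le> fitzpatrick c T (n - 1) z" "n_representable c n T"
  shows "maximal_n_monotone c n T"
proof -
  note m = one_le_enat_pred[OF assms(2)]
  let ?\<phi> = "fitzpatrick c T (n - 1)"
  obtain f where mono: "n_monotone c n T" and ge: "\<And>z. coupling c z \<le> f z"
    and le: "\<And>z. f z \<le> max (?\<phi> z) (fitzpatrick_conj c T (n - 1) z)"
    and eq: "Graph T = {z. f z = coupling c z}"
    using assms(4) unfolding n_representable_def by blast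
  have "z \<in> Graph T" if "?\<phi> z \<le> coupling c z" for z
  proof -
    have touch: "?\<phi> z = coupling c z" using that assms(3)[of z] by simp
    then have "fitzpatrick_conj c T (n - 1) z \<le> coupling c z"
      unfolding fitzpatrick_conj_def
      by (intro conjugate_le_coupling_of_touching ereal_convex_fitzpatrick assms m)
    then have "max (?\<phi> z) (fitzpatrick_conj c T (n - 1) z) \<le> coupling c z"
      using touch by simp
    then have "f z \<le> coupling c z"
      using le[of z] by (rule order_trans[rotated])
    then show ?thesis using ge[of z] eq by auto
  qed
  then show ?thesis
    using mono by (auto simp: maximal_n_monotone_iff_subset[OF assms(1,2)])
qed

lemma cond_C_imp_coupling_le_fitzpatrick:
  assumes "bilinear c" "2 \<le> n" "cond_C c T n x y"
  shows "coupling c (x, y) \<le> fitzpatrick c T (n - 1) (x, y)"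
proof -
  note m = one_le_enat_pred[OF assms(2)]
  obtain ps where "ps \<in> paths (n - 1) (Graph T)" "0 \<le> path_sum c x (ps @ [(x, y)])"
    using assms(3) unfolding cond_C_iff_path[OF assms(1,2)] by blast
  then show ?thesis
    using coupling_le_fitzpatrickI[OF assms(1) m, of ps T "(x, y)"] by simp
qed

lemma maximal_n_monotone_imp_cond_C:
  assumes "bilinear c" "2 \<le> n" "maximal_n_monotone c n T"
  shows "cond_C c T n x y"
  unfolding cond_C_iff_path[OF assms(1,2)]
proof (cases "(x, y) \<in> Graph T")
  case True
  obtain j where "replicate j (x, y) \<in> paths (n - 1) (Graph T)"
    using constant_path[OF assms(2) True] .
  moreover have "0 \<le> path_sum c x (replicate j (x, y) @ [(x, y)])"
    using path_sum_constant[OF assms(1), of "(x, y)" j] by simp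
  ultimately show "\<exists>ps\<in>paths (n - 1) (Graph T). 0 \<le> path_sum c x (ps @ [(x, y)])"
    by blast
next
  case False
  note m = one_le_enat_pred[OF assms(2)]
  have "coupling c (x, y) < fitzpatrick c T (n - 1) (x, y)"
    using False assms(3) by (auto simp: maximal_n_monotone_iff_Graph_eq[OF assms(1,2)])
  then show "\<exists>ps\<in>paths (n - 1) (Graph T). 0 \<le> path_sum c x (ps @ [(x, y)])"
    unfolding coupling_less_fitzpatrick_iff[OF assms(1) m] by (auto intro: less_imp_le)
qed

theorem theorem24:
  fixes c :: "'a::real_vector \<Rightarrow> 'b::real_vector \<Rightarrow> real"
    and T :: "'a \<Rightarrow> 'b set"
    and n :: enat
  assumes "bilinear c" and "2 \<le> n"
  shows
    "(maximal_n_monotone c n T \<longleftrightarrow>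
        n_monotone c n T \<and> {z. fitzpatrick c T (n - 1) z \<le> coupling c z} \<subseteq> Graph T) \<and>
     (maximal_n_monotone c n T \<longleftrightarrow>
        Graph T = {z. fitzpatrick c T (n - 1) z \<le> coupling c z}) \<and>
     (maximal_n_monotone c n T \<longleftrightarrow>
        (\<forall>z. coupling c z \<le> fitzpatrick c T (n - 1) z) \<and>
        Graph T = {z. fitzpatrick c T (n - 1) z = coupling c z}) \<and>
     (maximal_n_monotone c n T \<longleftrightarrow>
        (\<forall>z. coupling c z \<le> fitzpatrick c T (n - 1) z) \<and> n_representable c n T) \<and>
     (maximal_n_monotone c n T \<longleftrightarrow>
        n_representable c n T \<and> (\<forall>x y. cond_C c T n x y))"
proof (intro conjI)
  show "maximal_n_monotone c n T \<longleftrightarrow>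
      n_monotone c n T \<and> {z. fitzpatrick c T (n - 1) z \<le> coupling c z} \<subseteq> Graph T"
    by (rule maximal_n_monotone_iff_subset[OF assms])
  show "maximal_n_monotone c n T \<longleftrightarrow>
      Graph T = {z. fitzpatrick c T (n - 1) z \<le> coupling c z}"
    by (rule maximal_n_monotone_iff_Graph_eq[OF assms])
  show equality: "maximal_n_monotone c n T \<longleftrightarrow>
      (\<forall>z. coupling c z \<le> fitzpatrick c T (n - 1) z) \<and>
      Graph T = {z. fitzpatrick c T (n - 1) z = coupling c z}"
    by (rule maximal_n_monotone_iff_Graph_eq_equality_set[OF assms])
  show representable: "maximal_n_monotone c n T \<longleftrightarrow>
      (\<forall>z. coupling c z \<le> fitzpatrick c T (n - 1) z) \<and> n_representable c n T"
    using equality maximal_n_monotone_imp_n_representable[OF assms]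
      n_representable_imp_maximal_n_monotone[OF assms] by blast
  show "maximal_n_monotone c n T \<longleftrightarrow>
      n_representable c n T \<and> (\<forall>x y. cond_C c T n x y)"
  proof
    assume "maximal_n_monotone c n T"
    then show "n_representable c n T \<and> (\<forall>x y. cond_C c T n x y)"
      using representable maximal_n_monotone_imp_cond_C[OF assms] by blast
  next
    assume *: "n_representable c n T \<and> (\<forall>x y. cond_C c T n x y)"
    then have "coupling c z \<le> fitzpatrick c T (n - 1) z" for z
      using cond_C_imp_coupling_le_fitzpatrick[OF assms, of T "fst z" "snd z"] by simp
    then show "maximal_n_monotone c n T" using * representable by blast
  qed
qed

end
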